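(* $\overline\tau_+(K_n) = O(\log n)$ and $\overline\tau_-(K_n) = O(\log n)$. That is, there is a constant $C$ such that for all $n\ge 2$: there exist a straight-line drawing of $K_n$ and an edge-ordering of it in which every non-crossing increasing complete binary tree has at most $C\log n$ vertices; and there exist a straight-line drawing of $K_n$ and an edge-ordering of it in which every non-crossing decreasing complete binary tree has at most $C\log n$ vertices.
   Context: A geometric graph is a graph whose vertices are points in the plane in general position and whose edges are straight line segments; a straight-line drawing of $G$ is a geometric graph isomorphic to $G$. An edge-ordering is a total order on the edges. In an edge-ordered graph, a path $v_1v_2\ldots v_k$ is increasing if $(v_iv_{i+1}) > (v_{i+1}v_{i+2})$ for all $i=1,\ldots,k-2$ and decreasing if $(v_iv_{i+1}) < (v_{i+1}v_{i+2})$ for all $i$. All binary trees are complete and rooted (every internal vertex has exactly two children and all leaves are at the same depth); the size of a tree is its number of vertices. A rooted tree is increasing (resp. decreasing) if every path from the root to a leaf is increasing (resp. decreasing). A tree in a geometric graph is non-crossing if no two of its edges cross. $\overline\tau_+(\widetilde G)$ (resp. $\overline\tau_-(\widetilde G)$) is the minimum over all edge-orderings of $\widetilde G$ of the maximum size of a non-crossing increasing (resp. decreasing) binary tree in $\widetilde G$; $\overline\tau_+(G)$ (resp. $\overline\tau_-(G)$) is the minimum of $\overline\tau_+(\widetilde G)$ (resp. $\overline\tau_-(\widetilde G)$) over all straight-line drawings $\widetilde G$ of $G$. *)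

theory Defs
  imports
    "HOL-Analysis.Analysis"
    "HOL-Library.Tree"
    "HOL-Library.Landau_Symbols"
begin

record 'v ugraph =
  verts :: "'v set"
  edges :: "'v set set"

definition finite_simple_graph :: "'v ugraph \<Rightarrow> bool" where
  "finite_simple_graph G \<longleftrightarrow>
     finite (verts G) \<and> edges G \<subseteq> {e. e \<subseteq> verts G \<and> card e = 2}"

definition graph_isomorphic :: "'v ugraph \<Rightarrow> 'w ugraph \<Rightarrow> bool" where
  "graph_isomorphic G H \<longleftrightarrow>
     (\<exists>f. bij_betw f (verts G) (verts H) \<and> (\<lambda>e. f ` e) ` edges G = edges H)"

definition complete_ugraph :: "nat \<Rightarrow> nat ugraph" where
  "complete_ugraph n = \<lparr>verts = {..<n}, edges = {e. e \<subseteq> {..<n} \<and> card e = 2}\<rparr>"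

definition general_position :: "(real ^ 2) set \<Rightarrow> bool" where
  "general_position P \<longleftrightarrow> (\<forall>S\<subseteq>P. card S = 3 \<longrightarrow> \<not> collinear S)"

definition geometric_graph :: "(real ^ 2) ugraph \<Rightarrow> bool" where
  "geometric_graph D \<longleftrightarrow> finite_simple_graph D \<and> general_position (verts D)"

definition straight_line_drawing :: "(real ^ 2) ugraph \<Rightarrow> 'v ugraph \<Rightarrow> bool" where
  "straight_line_drawing D G \<longleftrightarrow> geometric_graph D \<and> graph_isomorphic G D"

text \<open>The edge \<open>{a, b}\<close> is drawn as the segment from \<open>a\<close> to \<open>b\<close>. Two distinct edges cross
  if they share a relative interior point; a common endpoint is not a crossing.\<close>

definition edges_cross :: "(real ^ 2) set \<Rightarrow> (real ^ 2) set \<Rightarrow> bool" where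
  "edges_cross e f \<longleftrightarrow> e \<noteq> f \<and>
     (\<exists>a b c d. e = {a, b} \<and> f = {c, d} \<and> open_segment a b \<inter> open_segment c d \<noteq> {})"

definition edge_ordering :: "'v ugraph \<Rightarrow> 'v set rel \<Rightarrow> bool" where
  "edge_ordering G r \<longleftrightarrow> linear_order_on (edges G) r"

text \<open>\<open>(e, f) \<in> r\<close> means \<open>e \<le> f\<close>, so \<open>(e, f) \<in> r - Id\<close> means \<open>e < f\<close>. Along an increasing
  path each edge is larger than its successor.\<close>

definition increasing_path :: "'v set rel \<Rightarrow> 'v list \<Rightarrow> bool" where
  "increasing_path r p \<longleftrightarrow>
     (\<forall>i. i + 2 < length p \<longrightarrow> ({p ! (i + 1), p ! (i + 2)}, {p ! i, p ! (i + 1)}) \<in> r - Id)"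

definition decreasing_path :: "'v set rel \<Rightarrow> 'v list \<Rightarrow> bool" where
  "decreasing_path r p \<longleftrightarrow>
     (\<forall>i. i + 2 < length p \<longrightarrow> ({p ! i, p ! (i + 1)}, {p ! (i + 1), p ! (i + 2)}) \<in> r - Id)"

text \<open>A rooted binary tree in a graph is represented by a \<open>'v tree\<close> with pairwise distinct labels.
  Its vertices are the labels of the \<open>Node\<close>s: a leaf of the graph-theoretic tree is a
  \<open>Node Leaf x Leaf\<close>, the constructor \<open>Leaf\<close> is the empty tree, and \<open>size\<close> counts
  vertices.\<close>

fun tree_edges :: "'v tree \<Rightarrow> 'v set set" where
  "tree_edges Leaf = {}"
| "tree_edges (Node l x r) =
     (case l of Leaf \<Rightarrow> {} | Node _ y _ \<Rightarrow> {{x, y}}) \<union>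
     (case r of Leaf \<Rightarrow> {} | Node _ y _ \<Rightarrow> {{x, y}}) \<union>
     tree_edges l \<union> tree_edges r"

fun root_leaf_paths :: "'v tree \<Rightarrow> 'v list set" where
  "root_leaf_paths Leaf = {}"
| "root_leaf_paths (Node l x r) =
     (if l = Leaf \<and> r = Leaf then {[x]}
      else (\<lambda>p. x # p) ` (root_leaf_paths l \<union> root_leaf_paths r))"

text \<open>\<open>Tree.complete\<close> puts all (empty) \<open>Leaf\<close>s at the same depth. Hence a vertex has either two
  or no children, and all vertices without children have the same depth.\<close>

definition binary_tree_in :: "'v ugraph \<Rightarrow> 'v tree \<Rightarrow> bool" where
  "binary_tree_in G t \<longleftrightarrow>
     t \<noteq> Leaf \<and> Tree.complete t \<and> distinct (inorder t) \<and>
     set_tree t \<subseteq> verts G \<and> tree_edges t \<subseteq> edges G"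

definition increasing_tree :: "'v set rel \<Rightarrow> 'v tree \<Rightarrow> bool" where
  "increasing_tree r t \<longleftrightarrow> (\<forall>p\<in>root_leaf_paths t. increasing_path r p)"

definition decreasing_tree :: "'v set rel \<Rightarrow> 'v tree \<Rightarrow> bool" where
  "decreasing_tree r t \<longleftrightarrow> (\<forall>p\<in>root_leaf_paths t. decreasing_path r p)"

definition non_crossing_tree :: "(real ^ 2) tree \<Rightarrow> bool" where
  "non_crossing_tree t \<longleftrightarrow> (\<forall>e\<in>tree_edges t. \<forall>f\<in>tree_edges t. \<not> edges_cross e f)"

text \<open>If \<open>D\<close> has a vertex, the maximum is over a finite nonempty set, as a single vertex is a tree
  of size 1. The infima are over sets of natural numbers; they are minima whenever the index set is
  nonempty.\<close>

definition tau_plus_geom :: "(real ^ 2) ugraph \<Rightarrow> nat" where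
  "tau_plus_geom D =
     (INF r\<in>{r. edge_ordering D r}.
        Max {size t |t. binary_tree_in D t \<and> non_crossing_tree t \<and> increasing_tree r t})"

definition tau_minus_geom :: "(real ^ 2) ugraph \<Rightarrow> nat" where
  "tau_minus_geom D =
     (INF r\<in>{r. edge_ordering D r}.
        Max {size t |t. binary_tree_in D t \<and> non_crossing_tree t \<and> decreasing_tree r t})"

definition tau_plus :: "'v ugraph \<Rightarrow> nat" where
  "tau_plus G = (INF D\<in>{D. straight_line_drawing D G}. tau_plus_geom D)"

definition tau_minus :: "'v ugraph \<Rightarrow> nat" where
  "tau_minus G = (INF D\<in>{D. straight_line_drawing D G}. tau_minus_geom D)"

end

theory Submission
  imports Defs
begin

text \<open>
  Place the vertices \<open>0, \<dots>, n - 1\<close> on a parabola, so that chords cross iff their endpoints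
  interleave. Let the level of the edge \<open>{i, j}\<close> be the least \<open>k\<close> such that \<open>i\<close> and \<open>j\<close> lie in
  the same dyadic block of length \<open>2 ^ k\<close>, and order the edges lexicographically by level, left
  endpoint and right endpoint. Consider a non-crossing decreasing tree, that is, one whose edges grow
  away from the root. Three consecutive edges of equal level on a path would contain a crossing, so
  below each vertex of height 3 there is a vertex \<open>w\<close>, entered by an edge of level \<open>< k\<close> and left by
  an edge of level \<open>k\<close>, for some \<open>k\<close>. All vertices reached before level \<open>k\<close> lie in the block of
  length \<open>2 ^ (k - 1)\<close> around the root, and the edge of level \<open>k\<close> at \<open>w\<close> leaves this block. Of three
  pairwise incomparable such \<open>w\<close> with the same \<open>k\<close>, the tree path from the root to one of the outer
  two has an edge that jumps over the middle one, and this edge crosses the level-\<open>k\<close> edge there.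
  So each of the \<open>O(log n)\<close> levels serves at most two vertices of height 3. Increasing trees are the
  decreasing trees of the converse ordering.
\<close>

subsection \<open>Levels and the order of the edges\<close>

text \<open>This is the number of binary digits of the exclusive or of \<open>i\<close> and
  \<open>j\<close>. As dyadic blocks are nested, it is an ultrametric on the naturals.\<close>

definition lev :: "nat \<Rightarrow> nat \<Rightarrow> nat" where
  "lev i j = (LEAST k. i div 2 ^ k = j div 2 ^ k)"

lemma div_pow2_mono_eq:
  fixes i j :: nat
  assumes "i div 2 ^ k = j div 2 ^ k" "k \<le> l"
  shows "i div 2 ^ l = j div 2 ^ l"
proof -
  have "(2::nat) ^ l = 2 ^ k * 2 ^ (l - k)"
    using assms(2) by (simp flip: power_add)
  then show ?thesis using assms(1) by (simp add: div_mult2_eq)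
qed

lemma lev_le_iff: "lev i j \<le> k \<longleftrightarrow> i div 2 ^ k = j div 2 ^ k"
proof
  \<comment> \<open>Any exponent that makes both quotients 0 would do; both numbers are below
    \<open>2 ^ (i + j)\<close>.\<close>
  have "i div 2 ^ (i + j) = j div 2 ^ (i + j)"
    by (simp add: power_add less_mult_imp_div_less trans_less_add1
        order.strict_trans2[OF less_exp])
  then have "i div 2 ^ lev i j = j div 2 ^ lev i j"
    unfolding lev_def by (rule LeastI)
  then show "lev i j \<le> k \<Longrightarrow> i div 2 ^ k = j div 2 ^ k"
    by (rule div_pow2_mono_eq)
next
  show "i div 2 ^ k = j div 2 ^ k \<Longrightarrow> lev i j \<le> k"
    unfolding lev_def by (rule Least_le)
qed

lemma lev_commute: "lev i j = lev j i"
  by (simp add: lev_def eq_commute)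

lemma lev_pos: "i \<noteq> j \<Longrightarrow> 0 < lev i j"
  using lev_le_iff[of i j 0] by (cases "lev i j") auto

lemma lev_less_trans: "lev i j < k \<Longrightarrow> lev j l < k \<Longrightarrow> lev i l < k"
  using lev_le_iff[of _ _ "k - 1"] by (cases k) (auto simp: less_Suc_eq_le)

text \<open>A block of length \<open>2 ^ k\<close> has two halves of length
  \<open>2 ^ (k - 1)\<close>. A pair of level \<open>k\<close> switches halves, so two switches lead
  back to the starting half.\<close>

lemma lev_same_side:
  assumes "lev i j = k" "lev j l = k" "i \<noteq> j"
  shows "lev i l < k"
proof -
  obtain k' where k: "k = Suc k'"
    using lev_pos[OF assms(3)] assms(1) by (cases k) auto
  have ne: "i div 2 ^ k' \<noteq> j div 2 ^ k'" "j div 2 ^ k' \<noteq> l div 2 ^ k'"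
    using lev_le_iff[of i j k'] lev_le_iff[of j l k'] assms k by auto
  have "i div 2 ^ k' div 2 = j div 2 ^ k' div 2" "j div 2 ^ k' div 2 = l div 2 ^ k' div 2"
    using lev_le_iff[of i j k] lev_le_iff[of j l k] assms k
    by (simp_all add: div_mult2_eq mult.commute[of 2])
  with ne have "i div 2 ^ k' = l div 2 ^ k'" by linarith
  then show ?thesis using lev_le_iff k by (simp add: less_Suc_eq_le)
qed

text \<open>Blocks are intervals: the smallest block containing \<open>i\<close> and
  \<open>l\<close> misses \<open>j\<close>, hence lies entirely on one side of
  \<open>j\<close>.\<close>

lemma lev_less_imp_less:
  assumes "lev i l < lev i j"
  shows "i < j \<Longrightarrow> l < j" "j < i \<Longrightarrow> j < l"
proof -
  define k where "k = lev i l"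
  have e: "i div 2 ^ k = l div 2 ^ k" and ne: "i div 2 ^ k \<noteq> j div 2 ^ k"
    using assms lev_le_iff[of i l k] lev_le_iff[of i j k] k_def by auto
  show "l < j" if "i < j"
    using e ne that div_le_mono[of i j "2^k"] div_le_mono[of j l "2^k"] by linarith
  show "j < l" if "j < i"
    using e ne that div_le_mono[of j i "2^k"] div_le_mono[of l j "2^k"] by linarith
qed

text \<open>Level, left end and right end are read as digits in base \<open>n\<close>, the level
  being an unbounded leading digit. For endpoints below \<open>n\<close>, comparing keys is
  comparing these triples lexicographically.\<close>

definition edge_key :: "nat \<Rightarrow> nat set \<Rightarrow> nat" where
  "edge_key n e = (lev (Min e) (Max e) * n + Min e) * n + Max e"

lemma mult_add_less_lex:
  fixes x x' y y' n :: nat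
  assumes "x * n + y < x' * n + y'" "y' < n"
  shows "x < x' \<or> x = x' \<and> y < y'"
proof (cases "x' < x")
  case True
  then have "Suc x' * n \<le> x * n" by (intro mult_le_mono1) simp
  with assms show ?thesis by simp
qed (use assms in \<open>auto simp: not_less le_less\<close>)

lemma mult_add_eq_lex:
  fixes x x' y y' n :: nat
  assumes "x * n + y = x' * n + y'" "y < n" "y' < n"
  shows "x = x' \<and> y = y'"
proof -
  have "(x * n + y) div n = x" "(x' * n + y') div n = x'" using assms(2,3) by simp_all
  with assms(1) show ?thesis by simp
qed

lemma edge_key_pair:
  assumes "a < b" shows "edge_key n {a, b} = (lev a b * n + a) * n + b"
  using assms by (simp add: edge_key_def)

lemma edge_key_less:
  assumes "edge_key n {a, b} < edge_key n {c, d}" "a < b" "c < d" "d < n"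
  shows "lev a b < lev c d \<or> lev a b = lev c d \<and> (a < c \<or> a = c \<and> b < d)"
proof -
  have "lev a b * n + a < lev c d * n + c \<or> lev a b * n + a = lev c d * n + c \<and> b < d"
    using assms mult_add_less_lex by (simp add: edge_key_pair)
  then show ?thesis
  proof
    assume "lev a b * n + a < lev c d * n + c"
    then show ?thesis using mult_add_less_lex[of "lev a b" n a "lev c d" c] assms by auto
  next
    assume "lev a b * n + a = lev c d * n + c \<and> b < d"
    then show ?thesis using mult_add_eq_lex[of "lev a b" n a "lev c d" c] assms by auto
  qed
qed

lemma edge_key_inj:
  assumes "edge_key n {a, b} = edge_key n {c, d}" "a < b" "c < d" "b < n" "d < n"
  shows "a = c \<and> b = d"
proof -
  have "lev a b * n + a = lev c d * n + c \<and> b = d"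
    by (rule mult_add_eq_lex) (use assms in \<open>simp_all add: edge_key_pair\<close>)
  then show ?thesis
    using mult_add_eq_lex[of "lev a b" n a "lev c d" c] assms by auto
qed

text \<open>For use along paths, where the endpoints of an edge come in either order; only the
  leading component of the key is kept.\<close>

lemma edge_key_less_lev:
  assumes "edge_key n {a, b} < edge_key n {c, d}" "a \<noteq> b" "c \<noteq> d" "c < n" "d < n"
  shows "lev a b \<le> lev c d"
proof -
  have "edge_key n {min a b, max a b} < edge_key n {min c d, max c d}"
    using assms(1) by (simp add: min_def max_def insert_commute)
  then have "lev (min a b) (max a b) \<le> lev (min c d) (max c d)"
    using edge_key_less[of n "min a b" "max a b" "min c d" "max c d"] assms
    by (simp add: min_less_iff_disj less_max_iff_disj) linarith
  then show ?thesis by (simp add: min_def max_def lev_commute split: if_splits)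
qed

text \<open>Crossing of chords in convex position. The relation is not symmetric, as the smallest
  endpoint belongs to the first edge; so non-crossing has to be used for both orders of the
  arguments.\<close>

definition interleaved :: "nat set \<Rightarrow> nat set \<Rightarrow> bool" where
  "interleaved e f \<longleftrightarrow> (\<exists>a b c d. a < b \<and> b < c \<and> c < d \<and> e = {a, c} \<and> f = {b, d})"

lemma interleavedI: "a < b \<Longrightarrow> b < c \<Longrightarrow> c < d \<Longrightarrow> interleaved {a, c} {b, d}"
  unfolding interleaved_def by blast

text \<open>The path zigzags between the halves of a block: \<open>a\<close> and \<open>c\<close>
  lie in one, \<open>b\<close> and \<open>d\<close> in the other. Consecutive edges share an
  endpoint, so the growing keys force \<open>a < c\<close> and \<open>b < d\<close>. Whichever half
  is on the left, the first and the third edge cross.\<close>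

lemma three_edges_same_lev_interleaved:
  assumes lev: "lev a b = k" "lev b c = k" "lev c d = k"
    and ne: "a \<noteq> b" "b \<noteq> c" "c \<noteq> d" and n: "a < n" "b < n" "c < n" "d < n"
    and key: "edge_key n {a, b} < edge_key n {b, c}" "edge_key n {b, c} < edge_key n {c, d}"
  shows "interleaved {a, b} {c, d}"
proof -
  have ac: "lev a c < k" and bd: "lev b d < k"
    using lev_same_side lev ne by blast+
  show ?thesis
  proof (cases "a < b")
    case True
    have "c < b" using lev_less_imp_less(1)[of a c b] ac lev True by simp
    moreover have "c < d" using lev_less_imp_less(2)[of b d c] bd lev \<open>c < b\<close> by simp
    moreover have "a < c"
      using edge_key_less[of n a b c b] key(1) True \<open>c < b\<close> lev n
      by (auto simp: insert_commute lev_commute)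
    moreover have "b < d"
      using edge_key_less[of n c b c d] key(2) \<open>c < d\<close> \<open>c < b\<close> lev n
      by (auto simp: insert_commute lev_commute)
    ultimately show ?thesis
      unfolding interleaved_def by blast
  next
    case False
    then have "b < a" using ne by simp
    have "b < c" using lev_less_imp_less(2)[of a c b] ac lev \<open>b < a\<close> by simp
    moreover have "d < c" using lev_less_imp_less(1)[of b d c] bd lev \<open>b < c\<close> by simp
    moreover have "d < a" using lev_less_imp_less(1)[of b d a] bd lev \<open>b < a\<close>
      by (simp add: lev_commute)
    moreover have "a < c"
      using edge_key_less[of n b a b c] key(1) \<open>b < a\<close> \<open>b < c\<close> lev n
      by (auto simp: insert_commute lev_commute)
    moreover have "b < d"
      using edge_key_less[of n b c d c] key(2) \<open>d < c\<close> \<open>b < c\<close> lev n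
      by (auto simp: insert_commute lev_commute)
    ultimately have "interleaved {b, a} {d, c}"
      by (blast intro: interleavedI)
    then show ?thesis by (simp add: insert_commute)
  qed
qed

subsection \<open>Families of non-crossing monotone paths\<close>

lemma card_le_mult_fibres:
  assumes "finite Q" "g ` Q \<subseteq> B" "finite B" "\<And>k. k \<in> B \<Longrightarrow> card {p \<in> Q. g p = k} \<le> c"
  shows "card Q \<le> card B * c"
proof -
  have "Q = (\<Union>k\<in>B. {p \<in> Q. g p = k})" using assms(2) by auto
  then have "card Q \<le> (\<Sum>k\<in>B. card {p \<in> Q. g p = k})"
    using card_UN_le[OF assms(3), of "\<lambda>k. {p \<in> Q. g p = k}"] by simp
  also have "\<dots> \<le> card B * c" using sum_bounded_above[of B, OF assms(4)] by simp
  finally show ?thesis .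
qed

lemma three_elements_sorted:
  fixes S :: "nat set"
  assumes "2 < card S"
  obtains x y z where "x \<in> S" "y \<in> S" "z \<in> S" "x < y" "y < z"
proof -
  have fin: "finite S" "S \<noteq> {}" using assms by (auto intro: card_ge_0_finite)
  have "\<not> S \<subseteq> {Min S, Max S}"
    using assms card_mono[of "{Min S, Max S}" S] card_insert_le_m1[of 2 "{Max S}" "Min S"]
    by auto
  then obtain y where "y \<in> S" "y \<noteq> Min S" "y \<noteq> Max S" by auto
  then show thesis
    using that[of "Min S" y "Max S"] fin by (simp add: order.strict_iff_order)
qed

text \<open>Discrete intermediate value argument; it finds the edge by which a path passes over a
  given point.\<close>

lemma sequence_jump:
  fixes f :: "nat \<Rightarrow> 'a"
  assumes "P (f 0)" "\<not> P (f i)"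
  obtains j where "j < i" "P (f j)" "\<not> P (f (Suc j))"
proof -
  define j where "j = (LEAST j. \<not> P (f j))"
  have j: "\<not> P (f j)" "j \<le> i" unfolding j_def using assms(2) by (rule LeastI, rule Least_le)
  then obtain j' where "j = Suc j'" using assms(1) by (cases j) auto
  then show thesis using that[of j'] j not_less_Least[of j' "\<lambda>j. \<not> P (f j)"] j_def by auto
qed

text \<open>The counting core, on vertex indices. The paths may share their first \<open>m\<close>
  vertices, while the last four belong to one path alone. These four span three edges, just enough
  to force a rise in level; each of the \<open>K\<close> possible levels is then charged by at most
  two paths.\<close>

lemma card_noncrossing_paths_le:
  fixes Q :: "nat list set"
  assumes fin: "finite Q"
    and len: "\<And>p. p \<in> Q \<Longrightarrow> length p = m + 4"
    and root: "\<And>p. p \<in> Q \<Longrightarrow> p ! 0 = \<rho>"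
    and less: "\<And>p. p \<in> Q \<Longrightarrow> set p \<subseteq> {..<n}" and n: "n \<le> 2 ^ K"
    and neq: "\<And>p i. p \<in> Q \<Longrightarrow> Suc i < m + 4 \<Longrightarrow> p ! i \<noteq> p ! Suc i"
    and key: "\<And>p i. p \<in> Q \<Longrightarrow> Suc (Suc i) < m + 4 \<Longrightarrow>
      edge_key n {p ! i, p ! Suc i} < edge_key n {p ! Suc i, p ! Suc (Suc i)}"
    and apart: "\<And>p q i. p \<in> Q \<Longrightarrow> q \<in> Q \<Longrightarrow> p \<noteq> q \<Longrightarrow> m \<le> i \<Longrightarrow> i < m + 4 \<Longrightarrow> p ! i \<notin> set q"
    and nc: "\<And>p q i j. p \<in> Q \<Longrightarrow> q \<in> Q \<Longrightarrow> Suc i < m + 4 \<Longrightarrow> Suc j < m + 4 \<Longrightarrow>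
      \<not> interleaved {p ! i, p ! Suc i} {q ! j, q ! Suc j}"
  shows "card Q \<le> K * 2"
proof -
  define l where "l p i = lev (p ! i) (p ! Suc i)" for p :: "nat list" and i
  have lt: "p ! i < n" if "p \<in> Q" "i < m + 4" for p i
    using less[OF that(1)] nth_mem[of i p] len[OF that(1)] that(2) by (metis lessThan_iff subsetD)
  have l_Suc: "l p i \<le> l p (Suc i)" if "p \<in> Q" "Suc (Suc i) < m + 4" for p i
    unfolding l_def using edge_key_less_lev[OF key[OF that] neq[of p i] neq[of p "Suc i"]] that lt
    by auto
  have l_mono: "l p i \<le> l p j" if "p \<in> Q" "i \<le> j" "Suc j < m + 4" for p i j
    using that(2,3)
  proof (induction j rule: dec_induct)
    case (step j)
    then show ?case using l_Suc[OF that(1), of j] by simp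
  qed simp
  \<comment> \<open>As long as its edges have level below \<open>k\<close>, a path stays in the
    block of length \<open>2 ^ (k - 1)\<close> around the root.\<close>
  have lev_root: "lev \<rho> (p ! i) < k" if "p \<in> Q" "i \<le> Suc j" "l p j < k" "Suc j < m + 4" for p i j k
    using that(2)
  proof (induction i)
    case 0
    have "lev \<rho> \<rho> = 0" using lev_le_iff[of \<rho> \<rho> 0] by simp
    then show ?case using root[OF that(1)] that(3) by simp
  next
    case (Suc i)
    have "l p i < k" using l_mono[of p i j] that Suc by simp
    then show ?case using lev_less_trans Suc unfolding l_def by (meson Suc_leD)
  qed
  \<comment> \<open>Levels never fall along a path. Without a rise, the last three edges would have
    equal level, and the first and third of them would cross.\<close>
  have "\<exists>i. m \<le> i \<and> i < m + 2 \<and> l p i < l p (Suc i)" if p: "p \<in> Q" for p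
  proof (rule ccontr)
    assume a: "\<not> ?thesis"
    have "l p m = l p (Suc m)" using a l_Suc[OF p, of m] by fastforce
    moreover have "l p (Suc m) = l p (Suc (Suc m))" using a l_Suc[OF p, of "Suc m"] by fastforce
    ultimately have "interleaved {p ! m, p ! Suc m} {p ! Suc (Suc m), p ! Suc (Suc (Suc m))}"
      by (intro three_edges_same_lev_interleaved[where n = n, OF _ _ refl])
         (use neq[OF p] key[OF p] lt[OF p] in \<open>simp_all add: l_def\<close>)
    then show False using nc[OF p p, of m "Suc (Suc m)"] by simp
  qed
  then obtain f where f: "m \<le> f p" "f p < m + 2" "l p (f p) < l p (Suc (f p))" if "p \<in> Q" for p
    by metis
  \<comment> \<open>The rise happens at \<open>w p\<close>, which is one of the last four vertices
    and thus private to \<open>p\<close>; \<open>g p\<close> is the level of the edge that leaves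
    it.\<close>
  define w where "w p = p ! Suc (f p)" for p
  define g where "g p = l p (Suc (f p))" for p
  \<comment> \<open>All indices lie in the block \<open>{..<2 ^ K}\<close>, which caps the level at
    \<open>K\<close>; it is positive because it exceeds the level before.\<close>
  have "g p \<in> {0<..K}" if p: "p \<in> Q" for p
  proof -
    have "p ! i < 2 ^ K" if "i < m + 4" for i using lt[OF p that] n by simp
    then show ?thesis
      using f[OF p] lev_le_iff[of "p ! Suc (f p)" "p ! Suc (Suc (f p))" K]
      by (auto simp: g_def l_def)
  qed
  then have img: "g ` Q \<subseteq> {0<..K}" by auto
  have w_notin: "w p \<notin> set q" if "p \<in> Q" "q \<in> Q" "p \<noteq> q" for p q
    using apart[OF that, of "Suc (f p)"] f[OF that(1)] by (simp add: w_def)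
  have "card {p \<in> Q. g p = k} \<le> 2" for k
  proof (rule ccontr)
    let ?F = "{p \<in> Q. g p = k}"
    have w_in: "w p \<in> set p" if "p \<in> Q" for p
      using that f(2)[OF that] len[OF that] by (simp add: w_def)
    have "inj_on w ?F" by (rule inj_onI) (use w_in w_notin in fastforce)
    moreover assume "\<not> card ?F \<le> 2"
    ultimately have "2 < card (w ` ?F)" by (simp add: card_image)
    then obtain x y z where "x \<in> w ` ?F" "y \<in> w ` ?F" "z \<in> w ` ?F" "x < y" "y < z"
      by (rule three_elements_sorted)
    then obtain p1 p p3 where p: "p1 \<in> ?F" "p \<in> ?F" "p3 \<in> ?F" "w p1 < w p" "w p < w p3"
      by auto
    \<comment> \<open>An edge of \<open>q\<close> up to \<open>w q\<close> has both ends in the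
      root's block of length \<open>2 ^ (k - 1)\<close>, as has \<open>w p\<close>. The
      level-\<open>k\<close> edge from \<open>w p\<close> leaves this block, so if the former edge
      jumps over \<open>w p\<close>, the latter ends beyond it and the two cross.\<close>
    have blocked: False if q: "q \<in> ?F" "q \<noteq> p" "j \<le> f q"
      and jump: "q ! j < w p \<and> w p < q ! Suc j \<or> q ! Suc j < w p \<and> w p < q ! j" for q j
    proof -
      have Q: "p \<in> Q" "q \<in> Q" using q p by auto
      have "l q (f q) < k" "l p (f p) < k" using f(3)[OF Q(1)] f(3)[OF Q(2)] q p by (simp_all add: g_def)
      then have r: "lev \<rho> (q ! j) < k" "lev \<rho> (q ! Suc j) < k" "lev \<rho> (w p) < k"
        unfolding w_def
        using lev_root[of q j "f q" k] lev_root[of q "Suc j" "f q" k]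
          lev_root[of p "Suc (f p)" "f p" k] q(3) f[OF Q(1)] f[OF Q(2)] Q
        by auto
      define v where "v = p ! Suc (Suc (f p))"
      have k: "lev (w p) v = k" using p by (simp add: w_def g_def l_def v_def)
      have s: "lev (w p) (q ! j) < lev (w p) v" "lev (w p) (q ! Suc j) < lev (w p) v"
        using r lev_less_trans[of "w p" \<rho> k] lev_commute[of \<rho> "w p"] unfolding k by simp_all
      have "w p \<noteq> v" using neq[OF Q(1), of "Suc (f p)"] f[OF Q(1)] by (simp add: w_def v_def)
      moreover have "\<not> interleaved {q ! j, q ! Suc j} {w p, v}" "\<not> interleaved {w p, v} {q ! j, q ! Suc j}"
        unfolding w_def v_def using nc[OF Q(2) Q(1), of j "Suc (f p)"]
          nc[OF Q(1) Q(2), of "Suc (f p)" j] q(3) f[OF Q(1)] f[OF Q(2)] by simp_all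
      \<comment> \<open>Four cases: the jump goes right or left, and \<open>v\<close> lies to the
        right or left of both its ends.\<close>
      ultimately show False
        using lev_less_imp_less[OF s(1)] lev_less_imp_less[OF s(2)] jump
          interleavedI[of "q ! j" "w p" "q ! Suc j" v] interleavedI[of "q ! Suc j" "w p" "q ! j" v]
          interleavedI[of v "q ! j" "w p" "q ! Suc j"] interleavedI[of v "q ! Suc j" "w p" "q ! j"]
        by (auto simp: insert_commute neq_iff)
    qed
    have notin: "q ! j \<noteq> w p" if "q \<in> ?F" "q \<noteq> p" "j < m + 4" for q j
      using w_notin[of p q] that p len[of q] nth_mem[of j q] by force
    show False
    \<comment> \<open>The path to the outer vertex on the far side of \<open>w p\<close>, seen from
      the root, has to pass \<open>w p\<close>. It cannot stop there, since \<open>w p\<close> lies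
      on no other path, so it jumps.\<close>
    proof (cases "\<rho> < w p")
      case True
      obtain j where j: "j < Suc (f p3)" "p3 ! j < w p" "\<not> p3 ! Suc j < w p"
        by (rule sequence_jump[of "\<lambda>x. x < w p" "\<lambda>i. p3 ! i" "Suc (f p3)"])
           (use p True root in \<open>auto simp: w_def\<close>)
      moreover have "p3 ! Suc j \<noteq> w p" using notin[of p3 "Suc j"] p j f(2)[of p3] by auto
      ultimately show False using blocked[of p3 j] p by auto
    next
      case False
      have "\<rho> \<noteq> w p" using notin[of p1 0] p root by auto
      obtain j where j: "j < Suc (f p1)" "w p < p1 ! j" "\<not> w p < p1 ! Suc j"
        by (rule sequence_jump[of "\<lambda>x. w p < x" "\<lambda>i. p1 ! i" "Suc (f p1)"])
           (use p False \<open>\<rho> \<noteq> w p\<close> root in \<open>auto simp: w_def\<close>)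
      moreover have "p1 ! Suc j \<noteq> w p" using notin[of p1 "Suc j"] p j f(2)[of p1] by auto
      ultimately show False using blocked[of p1 j] p by auto
    qed
  qed
  then show ?thesis using card_le_mult_fibres[OF fin img] by simp
qed

subsection \<open>Root-leaf paths of complete trees\<close>

text \<open>No shift by one occurs: with \<open>Leaf\<close> as the empty tree,
  \<open>height\<close> counts the vertices of a root-leaf path.\<close>

lemma root_leaf_paths_complete:
  assumes "complete t" "p \<in> root_leaf_paths t"
  shows "length p = height t \<and> set p \<subseteq> set_tree t \<and> p ! 0 = value t"
  using assms
proof (induction t arbitrary: p)
  case (Node l x r)
  show ?case
  proof (cases "l = Leaf \<and> r = Leaf")
    case False
    then obtain q s where q: "p = x # q" "q \<in> root_leaf_paths s" "s = l \<or> s = r"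
      using Node.prems by auto
    then have "length q = height s \<and> set q \<subseteq> set_tree s" using Node by auto
    then show ?thesis using q Node.prems(1) by auto
  qed (use Node.prems in simp)
qed simp

lemma root_leaf_paths_edges:
  assumes "complete t" "p \<in> root_leaf_paths t" "Suc i < length p"
  shows "{p ! i, p ! Suc i} \<in> tree_edges t"
  using assms
proof (induction t arbitrary: p i)
  case (Node l x r)
  show ?case
  proof (cases "l = Leaf \<and> r = Leaf")
    case False
    then obtain q s where q: "p = x # q" "q \<in> root_leaf_paths s" "s = l \<or> s = r"
      using Node.prems by auto
    have s: "complete s" "s \<noteq> Leaf" using q Node.prems by auto
    show ?thesis
    proof (cases i)
      case 0
      then have "{p ! i, p ! Suc i} = {x, value s}"
        using root_leaf_paths_complete[OF s(1) q(2)] q by simp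
      then show ?thesis using q(3) s(2) by (cases s) auto
    next
      case (Suc j)
      then have "{p ! i, p ! Suc i} \<in> tree_edges s"
        using Node.IH q s Node.prems(3) by auto
      then show ?thesis using q(3) by auto
    qed
  qed (use Node.prems in simp)
qed simp

lemma root_leaf_paths_nonempty: "t \<noteq> Leaf \<Longrightarrow> root_leaf_paths t \<noteq> {}"
  by (induction t) (auto split: if_splits)

text \<open>Each of the \<open>2 ^ m\<close> vertices at depth \<open>m\<close> is continued to a
  leaf. The subtrees at these vertices are disjoint, so two chosen paths can share vertices only
  above depth \<open>m\<close>.\<close>

lemma separated_root_leaf_paths:
  assumes "complete t" "distinct (inorder t)" "height t = m + Suc k"
  shows "\<exists>P\<subseteq>root_leaf_paths t. finite P \<and> card P = 2 ^ m \<and>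
    (\<forall>p\<in>P. \<forall>q\<in>P. p \<noteq> q \<longrightarrow> (\<forall>i. m \<le> i \<and> i < length p \<longrightarrow> p ! i \<notin> set q))"
  using assms
proof (induction m arbitrary: t)
  case 0
  then obtain p where "p \<in> root_leaf_paths t"
    using root_leaf_paths_nonempty[of t] by fastforce
  then show ?case by (intro exI[of _ "{p}"]) auto
next
  case (Suc m)
  then obtain l x r where t: "t = Node l x r" by (cases t) auto
  have c: "complete l" "complete r" "height l = m + Suc k" "height r = m + Suc k"
    and d: "distinct (inorder l)" "distinct (inorder r)" "x \<notin> set_tree l" "x \<notin> set_tree r"
      "set_tree l \<inter> set_tree r = {}"
    using Suc.prems by (auto simp: t)
  obtain L where L: "L \<subseteq> root_leaf_paths l" "finite L" "card L = 2 ^ m"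
    "\<forall>p\<in>L. \<forall>q\<in>L. p \<noteq> q \<longrightarrow> (\<forall>i. m \<le> i \<and> i < length p \<longrightarrow> p ! i \<notin> set q)"
    using Suc.IH[OF c(1) d(1) c(3)] by (elim exE conjE)
  obtain R where R: "R \<subseteq> root_leaf_paths r" "finite R" "card R = 2 ^ m"
    "\<forall>p\<in>R. \<forall>q\<in>R. p \<noteq> q \<longrightarrow> (\<forall>i. m \<le> i \<and> i < length p \<longrightarrow> p ! i \<notin> set q)"
    using Suc.IH[OF c(2) d(2) c(4)] by (elim exE conjE)
  have sets: "set p \<subseteq> set_tree l" "p \<noteq> []" if "p \<in> L" for p
    using root_leaf_paths_complete[OF c(1), of p] L(1) that c(3) by auto
  have setr: "set p \<subseteq> set_tree r" "p \<noteq> []" if "p \<in> R" for p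
    using root_leaf_paths_complete[OF c(2), of p] R(1) that c(4) by auto
  have LR: "p ! i \<notin> set q \<and> q ! j \<notin> set p"
    if "p \<in> L" "q \<in> R" "i < length p" "j < length q" for p q i j
    using sets[OF that(1)] setr[OF that(2)] d(5) nth_mem[OF that(3)] nth_mem[OF that(4)] by blast
  have x: "p ! i \<noteq> x" if "p \<in> L \<union> R" "i < length p" for p i
    using that sets setr d nth_mem[OF that(2)] by blast
  have "L \<inter> R = {}"
    using sets setr d(5) by (metis Int_iff equals0I le_inf_iff set_empty2 subset_empty)
  then have "card ((#) x ` (L \<union> R)) = 2 ^ Suc m"
    using L R by (simp add: card_image card_Un_disjoint)
  moreover have "(#) x ` (L \<union> R) \<subseteq> root_leaf_paths t"
    using L(1) R(1) c by (auto simp: t)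
  moreover have "p ! i \<notin> set q"
    if pq: "p \<in> (#) x ` (L \<union> R)" "q \<in> (#) x ` (L \<union> R)" "p \<noteq> q" "Suc m \<le> i" "i < length p" for p q i
  proof -
    obtain p' q' j where e: "p = x # p'" "q = x # q'" "i = Suc j" "p' \<in> L \<union> R" "q' \<in> L \<union> R"
      using pq(1,2,4) by (cases i) auto
    then have j: "m \<le> j" "j < length p'" "p' \<noteq> q'" using pq by auto
    \<comment> \<open>This makes 0 a valid index into \<open>q'\<close>, as \<open>LR\<close> asks
      for an index into either path.\<close>
    have "q' \<noteq> []" using e sets setr by blast
    then have "p' ! j \<notin> set q'"
      using e j L(4) R(4) LR[of p' q' j 0] LR[of q' p' 0 j] by blast
    then show ?thesis using e j x by simp
  qed
  ultimately show ?case
    using L(2) R(2) by (intro exI[of _ "(#) x ` (L \<union> R)"]) blast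
qed

subsection \<open>Points on a parabola\<close>

definition parabola :: "real \<Rightarrow> real ^ 2" where
  "parabola x = vector [x, x\<^sup>2]"

lemma parabola_nth [simp]: "parabola x $ 1 = x" "parabola x $ 2 = x\<^sup>2"
  by (simp_all add: parabola_def)

text \<open>\<open>(a + c) * x - a * c\<close> is the height at \<open>x\<close> of the line through
  the two points.\<close>

lemma chord_open_segment:
  fixes a c x :: real
  assumes "a < x" "x < c"
  shows "vector [x, (a + c) * x - a * c] \<in> open_segment (parabola a) (parabola c)"
proof -
  define u where "u = (x - a) / (c - a)"
  have u: "0 < u" "u < 1" "u * (c - a) = x - a" using assms by (auto simp: u_def)
  have "x = (1 - u) * a + u * c" using u(3) by (simp add: algebra_simps)
  moreover have "(a + c) * x - a * c = (1 - u) * a\<^sup>2 + u * c\<^sup>2"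
  proof -
    have "(1 - u) * a\<^sup>2 + u * c\<^sup>2 = a\<^sup>2 + (u * (c - a)) * (c + a)"
      by (simp add: algebra_simps power2_eq_square)
    then show ?thesis unfolding u(3) by (simp add: algebra_simps power2_eq_square)
  qed
  ultimately have "vector [x, (a + c) * x - a * c] = (1 - u) *\<^sub>R parabola a + u *\<^sub>R parabola c"
    by (simp add: vec_eq_iff forall_2)
  moreover have "parabola a \<noteq> parabola c"
    using assms by (metis parabola_nth(1) less_trans order_less_irrefl)
  ultimately show ?thesis unfolding in_segment using u by blast
qed

lemma parabola_chords_cross:
  fixes a b c d :: real
  assumes "a < b" "b < c" "c < d"
  shows "edges_cross {parabola a, parabola c} {parabola b, parabola d}"
proof -
  \<comment> \<open>The abscissa at which the lines of the two chords meet.\<close>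
  define x where "x = (b * d - a * c) / (b + d - a - c)"
  have pos: "0 < b + d - a - c" using assms by simp
  have x: "x * (b + d - a - c) = b * d - a * c" using pos by (simp add: x_def)
  \<comment> \<open>These products equal \<open>(x - b) * (b + d - a - c)\<close> and
    \<open>(c - x) * (b + d - a - c)\<close>, which puts \<open>x\<close> between \<open>b\<close>
    and \<open>c\<close>.\<close>
  have "0 < (b - a) * (c - b)" "0 < (c - b) * (d - c)" using assms by simp_all
  then have "b * (b + d - a - c) < x * (b + d - a - c)" "x * (b + d - a - c) < c * (b + d - a - c)"
    unfolding x by (simp_all add: algebra_simps)
  then have bx: "b < x" "x < c" using pos by simp_all
  have "(a + c) * x - a * c = (b + d) * x - b * d" using x by (simp add: algebra_simps)
  then have "open_segment (parabola a) (parabola c) \<inter> open_segment (parabola b) (parabola d) \<noteq> {}"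
    using chord_open_segment[of a x c] chord_open_segment[of b x d] bx assms by auto
  moreover have "{parabola a, parabola c} \<noteq> {parabola b, parabola d}"
    using assms by (metis doubleton_eq_iff less_irrefl less_trans parabola_nth(1))
  ultimately show ?thesis unfolding edges_cross_def by blast
qed

lemma general_position_parabola: "general_position (parabola ` X)"
  unfolding general_position_def
proof (intro allI impI notI)
  fix S assume S: "S \<subseteq> parabola ` X" "card S = 3" "collinear S"
  obtain x y z where xyz: "S = {x, y, z}" "x \<noteq> y" "y \<noteq> z" "x \<noteq> z"
    using S(2) unfolding card_3_iff by auto
  then obtain a b c where "x = parabola a" "y = parabola b" "z = parabola c"
    using S(1) by auto
  with xyz have abc: "S = {parabola a, parabola b, parabola c}"
    and ne: "a \<noteq> b" "b \<noteq> c" "a \<noteq> c" by auto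
  obtain u k l where "parabola b - parabola a = k *\<^sub>R u" "parabola c - parabola a = l *\<^sub>R u"
    using S(3) abc unfolding collinear_def by blast
  then have "b - a = k * u $ 1" "c - a = l * u $ 1" "b\<^sup>2 - a\<^sup>2 = k * u $ 2" "c\<^sup>2 - a\<^sup>2 = l * u $ 2"
    by (metis parabola_nth vector_minus_component vector_scaleR_component real_scaleR_def)+
  \<comment> \<open>The determinant of two multiples of \<open>u\<close> vanishes; here it is a
    Vandermonde determinant and factors.\<close>
  then have "(b - a) * (c\<^sup>2 - a\<^sup>2) - (c - a) * (b\<^sup>2 - a\<^sup>2) = 0" by simp
  then have "(b - a) * (c - a) * (c - b) = 0" by (simp add: algebra_simps power2_eq_square)
  then show False using ne by simp
qed

section \<open>The drawing of the complete graph and the ordering of its edges\<close>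

definition parabola_drawing :: "nat \<Rightarrow> (real ^ 2) ugraph" where
  "parabola_drawing n =
    (let V = (\<lambda>i. parabola (real i)) ` {..<n} in \<lparr>verts = V, edges = {e. e \<subseteq> V \<and> card e = 2}\<rparr>)"

lemma inj_parabola_nat: "inj (\<lambda>i::nat. parabola (real i))"
  by (rule injI) (metis of_nat_eq_iff parabola_nth(1))

lemma straight_line_drawing_parabola:
  "straight_line_drawing (parabola_drawing n) (complete_ugraph n)"
proof -
  let ?f = "\<lambda>i::nat. parabola (real i)"
  have inj: "inj_on ?f A" for A using inj_parabola_nat inj_on_subset by blast
  have "general_position (?f ` {..<n})"
    using general_position_parabola[of "real ` {..<n}"] by (simp add: image_image)
  then have "geometric_graph (parabola_drawing n)"
    by (simp add: geometric_graph_def finite_simple_graph_def parabola_drawing_def Let_def)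
  moreover have "(`) ?f ` {e. e \<subseteq> {..<n} \<and> card e = 2} = {e. e \<subseteq> ?f ` {..<n} \<and> card e = 2}"
    (is "?A = ?B")
  proof
    show "?A \<subseteq> ?B" using card_image[OF inj] by auto
    show "?B \<subseteq> ?A"
    proof
      fix e assume "e \<in> ?B"
      then obtain s where "s \<subseteq> {..<n}" "e = ?f ` s" "card e = 2"
        by (auto simp: subset_image_iff)
      then show "e \<in> ?A" using card_image[OF inj, of s] by auto
    qed
  qed
  ultimately show ?thesis
    using inj[of "{..<n}"]
    by (auto simp: straight_line_drawing_def graph_isomorphic_def parabola_drawing_def Let_def
        complete_ugraph_def bij_betw_def intro!: exI[of _ ?f])
qed

text \<open>Recovers the index of a vertex of the drawing; rounding only serves to return a natural
  number.\<close>

definition coord :: "real ^ 2 \<Rightarrow> nat" where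
  "coord v = nat \<lfloor>v $ 1\<rfloor>"

lemma coord_parabola [simp]: "coord (parabola (real i)) = i"
  by (simp add: coord_def)

lemma parabola_drawing_verts:
  "v \<in> verts (parabola_drawing n) \<longleftrightarrow> v = parabola (real (coord v)) \<and> coord v < n"
proof
  assume "v \<in> verts (parabola_drawing n)"
  then show "v = parabola (real (coord v)) \<and> coord v < n"
    by (auto simp: parabola_drawing_def Let_def)
next
  assume "v = parabola (real (coord v)) \<and> coord v < n"
  then show "v \<in> verts (parabola_drawing n)"
    by (simp add: parabola_drawing_def Let_def) blast
qed

lemma inj_on_coord: "inj_on coord (verts (parabola_drawing n))"
  by (rule inj_onI) (metis parabola_drawing_verts)

lemma parabola_drawing_edgesE:
  assumes "e \<in> edges (parabola_drawing n)"
  obtains i j where "i < j" "j < n" "e = {parabola (real i), parabola (real j)}"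
proof -
  obtain u v where e: "e = {u, v}" "u \<noteq> v"
    using assms unfolding parabola_drawing_def Let_def by (auto simp: card_2_iff)
  moreover have "u \<in> verts (parabola_drawing n)" "v \<in> verts (parabola_drawing n)"
    using assms e by (auto simp: parabola_drawing_def Let_def)
  ultimately obtain i j where "u = parabola (real i)" "v = parabola (real j)" "i \<noteq> j" "i < n" "j < n"
    by (metis parabola_drawing_verts)
  then show thesis
    using that[of i j] that[of j i] e by (auto simp: insert_commute neq_iff)
qed

definition lev_order :: "nat \<Rightarrow> (real ^ 2) set rel" where
  "lev_order n = {(e, f). e \<in> edges (parabola_drawing n) \<and> f \<in> edges (parabola_drawing n) \<and>
     edge_key n (coord ` e) \<le> edge_key n (coord ` f)}"

lemma edge_ordering_lev_order: "edge_ordering (parabola_drawing n) (lev_order n)"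
proof -
  have "e = f" if ef: "e \<in> edges (parabola_drawing n)" "f \<in> edges (parabola_drawing n)"
    and key: "edge_key n (coord ` e) = edge_key n (coord ` f)" for e f
  proof -
    obtain a b where e: "a < b" "b < n" "e = {parabola (real a), parabola (real b)}"
      using ef(1) by (rule parabola_drawing_edgesE)
    obtain c d where f: "c < d" "d < n" "f = {parabola (real c), parabola (real d)}"
      using ef(2) by (rule parabola_drawing_edgesE)
    show "e = f" using edge_key_inj[of n a b c d] key e f by simp
  qed
  then show ?thesis
    unfolding edge_ordering_def linear_order_on_def partial_order_on_def preorder_on_def
      refl_on_def trans_def antisym_def total_on_def lev_order_def
    by (auto intro: order_antisym)
qed

lemma edge_key_less_if_lev_order:
  assumes "(e, f) \<in> lev_order n - Id"
  shows "edge_key n (coord ` e) < edge_key n (coord ` f)"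
proof -
  have "(f, e) \<notin> lev_order n"
    using assms edge_ordering_lev_order[of n]
    unfolding edge_ordering_def linear_order_on_def partial_order_on_def antisym_def by blast
  then show ?thesis using assms by (auto simp: lev_order_def not_le)
qed

subsection \<open>The bound on the tree size\<close>

text \<open>For height \<open>m + 4\<close> there are \<open>2 ^ m\<close> separated paths, so
  \<open>2 ^ m\<close> is at most \<open>2 * K\<close>, and the tree has fewer than
  \<open>2 ^ (m + 4)\<close> vertices. Trees of height at most 3 have at most 7 vertices.\<close>

lemma size_decreasing_tree_le:
  assumes t: "binary_tree_in (parabola_drawing n) t" "non_crossing_tree t"
      "decreasing_tree (lev_order n) t"
    and K: "n \<le> 2 ^ K" "1 \<le> K"
  shows "size t \<le> 32 * K"
proof (cases "height t < 4")
  case True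
  have "size1 t = 2 ^ height t" using t(1) by (simp add: binary_tree_in_def size1_if_complete)
  also have "\<dots> \<le> (2::nat) ^ 3" using True by (intro power_increasing) auto
  finally show ?thesis using K(2) by (simp add: size1_size)
next
  case False
  let ?D = "parabola_drawing n"
  define m where "m = height t - 4"
  have c: "complete t" "distinct (inorder t)" "set_tree t \<subseteq> verts ?D" "tree_edges t \<subseteq> edges ?D"
    using t(1) by (auto simp: binary_tree_in_def)
  have h: "height t = m + Suc 3" using False by (simp add: m_def)
  obtain P where P: "P \<subseteq> root_leaf_paths t" "finite P" "card P = 2 ^ m"
    "\<forall>p\<in>P. \<forall>q\<in>P. p \<noteq> q \<longrightarrow> (\<forall>i. m \<le> i \<and> i < length p \<longrightarrow> p ! i \<notin> set q)"
    using separated_root_leaf_paths[OF c(1,2) h] by (elim exE conjE)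
  have len: "length p = m + 4" and root: "p ! 0 = value t" and sub: "set p \<subseteq> verts ?D"
    if "p \<in> P" for p
    using root_leaf_paths_complete[OF c(1), of p] that P(1) h c(3) by auto
  have edge: "{p ! i, p ! Suc i} \<in> tree_edges t" if "p \<in> P" "Suc i < m + 4" for p i
    using root_leaf_paths_edges[OF c(1), of p i] that P(1) len by auto
  have coord_eq: "coord u = coord v \<longleftrightarrow> u = v" if "u \<in> verts ?D" "v \<in> verts ?D" for u v
    using that inj_on_coord by (auto dest: inj_onD)
  have nth: "p ! i \<in> verts ?D" if "p \<in> P" "i < m + 4" for p i
    using sub[OF that(1)] len[OF that(1)] that(2) nth_mem[of i p] by auto
  \<comment> \<open>Passing from points to indices must not merge paths, since the indexed paths are
    the ones counted.\<close>
  have "inj_on (map coord) P"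
  proof (rule inj_onI)
    fix p q assume "p \<in> P" "q \<in> P" "map coord p = map coord q"
    moreover have "inj_on coord (set p \<union> set q)"
      using sub \<open>p \<in> P\<close> \<open>q \<in> P\<close> by (intro inj_on_subset[OF inj_on_coord]) auto
    ultimately show "p = q" by (simp add: inj_on_map_eq_map)
  qed
  then have "card (map coord ` P) = 2 ^ m" using P(3) by (simp add: card_image)
  moreover have "card (map coord ` P) \<le> K * 2"
  proof (rule card_noncrossing_paths_le[where m = m and n = n and \<rho> = "coord (value t)"])
    fix p' assume "p' \<in> map coord ` P"
    then obtain p where p: "p \<in> P" "p' = map coord p" by auto
    show "length p' = m + 4" using p len by simp
    show "p' ! 0 = coord (value t)" using p len root by simp
    show "set p' \<subseteq> {..<n}" using p sub parabola_drawing_verts by fastforce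
    show "p' ! i \<noteq> p' ! Suc i" if i: "Suc i < m + 4" for i
    proof -
      have "p ! i \<noteq> p ! Suc i"
        using edge[OF p(1) i] c(4) by (auto simp: parabola_drawing_def Let_def)
      then show ?thesis using p i len coord_eq nth by simp
    qed
    show "edge_key n {p' ! i, p' ! Suc i} < edge_key n {p' ! Suc i, p' ! Suc (Suc i)}"
      if i: "Suc (Suc i) < m + 4" for i
    proof -
      have "decreasing_path (lev_order n) p" using t(3) p(1) P(1) by (auto simp: decreasing_tree_def)
      then have "({p ! i, p ! Suc i}, {p ! Suc i, p ! Suc (Suc i)}) \<in> lev_order n - Id"
        using i len[OF p(1)] by (simp add: decreasing_path_def)
      from edge_key_less_if_lev_order[OF this] show ?thesis using p i len by simp
    qed
    fix q' assume "q' \<in> map coord ` P"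
    then obtain q where q: "q \<in> P" "q' = map coord q" by auto
    show "p' ! i \<notin> set q'" if "p' \<noteq> q'" "m \<le> i" "i < m + 4" for i
    proof -
      have "p \<noteq> q" "i < length p" using that p q len[OF p(1)] by auto
      then have "p ! i \<notin> set q" using P(4) p(1) q(1) that(2) by blast
      then have "coord (p ! i) \<notin> coord ` set q"
        using inj_on_image_mem_iff[OF inj_on_coord nth[OF p(1) that(3)] sub[OF q(1)]] by simp
      then show ?thesis using p(2) q(2) \<open>i < length p\<close> by simp
    qed
    show "\<not> interleaved {p' ! i, p' ! Suc i} {q' ! j, q' ! Suc j}"
      if i: "Suc i < m + 4" and j: "Suc j < m + 4" for i j
    proof
      assume "interleaved {p' ! i, p' ! Suc i} {q' ! j, q' ! Suc j}"
      then obtain a b c d where o: "a < b" "b < c" "c < d"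
        and e: "{p' ! i, p' ! Suc i} = {a, c}" "{q' ! j, q' ! Suc j} = {b, d}"
        unfolding interleaved_def by blast
      let ?f = "\<lambda>i. parabola (real i)"
      have "?f ` {p' ! i, p' ! Suc i} = {p ! i, p ! Suc i}"
        "?f ` {q' ! j, q' ! Suc j} = {q ! j, q ! Suc j}"
        using p q i j len nth parabola_drawing_verts by simp_all
      then have "edges_cross {p ! i, p ! Suc i} {q ! j, q ! Suc j}"
        using parabola_chords_cross[of a b c d] o unfolding e by simp
      then show False using edge[OF p(1) i] edge[OF q(1) j] t(2) by (auto simp: non_crossing_tree_def)
    qed
  qed (use P K in auto)
  moreover have "size1 t = 2 ^ (m + 4)" using c(1) h by (simp add: size1_if_complete)
  ultimately show ?thesis by (simp add: size1_size power_add)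
qed

lemma size_decreasing_tree_le_ln:
  assumes "2 \<le> n" "binary_tree_in (parabola_drawing n) t" "non_crossing_tree t"
      "decreasing_tree (lev_order n) t"
  shows "real (size t) \<le> 64 / ln 2 * ln (real n)"
proof -
  define K where "K = nat \<lceil>log 2 (real n)\<rceil>"
  have l: "1 \<le> log 2 (real n)" using assms(1) by simp
  \<comment> \<open>Rounding up costs less than 1, which is at most \<open>log 2 (real n)\<close> as
    \<open>n\<close> is at least 2. This doubles the constant from 32 to 64.\<close>
  then have K: "log 2 (real n) \<le> real K" "real K \<le> 2 * log 2 (real n)" "1 \<le> K"
    unfolding K_def by linarith+
  have "real n = 2 powr log 2 (real n)" using assms(1) by simp
  also have "\<dots> \<le> 2 powr real K" using K(1) by (intro powr_mono) auto
  finally have "n \<le> 2 ^ K" by (simp add: powr_realpow flip: of_nat_le_iff)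
  then have "size t \<le> 32 * K" using size_decreasing_tree_le assms K(3) by blast
  then have "real (size t) \<le> 32 * real K" by linarith
  also have "\<dots> \<le> 64 / ln 2 * ln (real n)" using K(2) by (simp add: log_def)
  finally show ?thesis .
qed

section \<open>Increasing trees and the passage to the minima\<close>

lemma increasing_tree_converse: "increasing_tree (r\<inverse>) t \<longleftrightarrow> decreasing_tree r t"
  by (auto simp: increasing_tree_def decreasing_tree_def increasing_path_def decreasing_path_def)

lemma edge_ordering_converse: "edge_ordering G r \<Longrightarrow> edge_ordering G (r\<inverse>)"
  by (simp add: edge_ordering_def)

text \<open>\<open>Max\<close> is meaningful only on a finite nonempty set: the bound
  \<open>B\<close> makes the set of sizes finite, and the one-vertex tree makes it nonempty.
  \<open>Q\<close> stands for either kind of monotonicity.\<close>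

lemma Max_sizes_le:
  assumes "v \<in> verts D" "Q (Node Leaf v Leaf)"
    and "\<And>t. binary_tree_in D t \<Longrightarrow> non_crossing_tree t \<Longrightarrow> Q t \<Longrightarrow> real (size t) \<le> B"
  shows "real (Max {size t |t. binary_tree_in D t \<and> non_crossing_tree t \<and> Q t}) \<le> B"
proof -
  let ?S = "{size t |t. binary_tree_in D t \<and> non_crossing_tree t \<and> Q t}"
  have "?S \<subseteq> {..nat \<lfloor>B\<rfloor>}" using assms(3) by (auto intro!: le_nat_floor)
  then have "finite ?S" by (rule finite_subset) simp
  moreover have "size (Node Leaf v Leaf) \<in> ?S"
    using assms(1,2) by (auto simp: binary_tree_in_def non_crossing_tree_def
        intro!: exI[of _ "Node Leaf v Leaf"])
  ultimately have "Max ?S \<in> ?S" by (intro Max_in) auto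
  then show ?thesis using assms(3) by auto
qed

lemma singleton_tree_monotone:
  "increasing_tree r (Node Leaf v Leaf)" "decreasing_tree r (Node Leaf v Leaf)"
  by (simp_all add: increasing_tree_def decreasing_tree_def increasing_path_def decreasing_path_def)

theorem theorem5:
  shows "(\<lambda>n. real (tau_plus (complete_ugraph n))) \<in> O(\<lambda>n. ln (real n))
    \<and> (\<lambda>n. real (tau_minus (complete_ugraph n))) \<in> O(\<lambda>n. ln (real n))
    \<and> (\<exists>C::real. \<forall>n::nat. n \<ge> 2 \<longrightarrow>
          (\<exists>D r. straight_line_drawing D (complete_ugraph n) \<and> edge_ordering D r \<and>
             (\<forall>t. binary_tree_in D t \<and> non_crossing_tree t \<and> increasing_tree r t
                \<longrightarrow> real (size t) \<le> C * ln (real n)))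
        \<and> (\<exists>D r. straight_line_drawing D (complete_ugraph n) \<and> edge_ordering D r \<and>
             (\<forall>t. binary_tree_in D t \<and> non_crossing_tree t \<and> decreasing_tree r t
                \<longrightarrow> real (size t) \<le> C * ln (real n))))"
proof (intro conjI)
  define C :: real where "C = 64 / ln 2"
  note draw = straight_line_drawing_parabola edge_ordering_lev_order
    edge_ordering_converse[OF edge_ordering_lev_order]
  have dec: "real (size t) \<le> C * ln (real n)"
    if "2 \<le> n" "binary_tree_in (parabola_drawing n) t" "non_crossing_tree t"
      "decreasing_tree (lev_order n) t" for n t
    using size_decreasing_tree_le_ln[OF that] by (simp add: C_def)
  have inc: "real (size t) \<le> C * ln (real n)"
    if "2 \<le> n" "binary_tree_in (parabola_drawing n) t" "non_crossing_tree t"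
      "increasing_tree ((lev_order n)\<inverse>) t" for n t
    using dec that by (simp add: increasing_tree_converse)
  show "\<exists>C::real. \<forall>n::nat. n \<ge> 2 \<longrightarrow>
          (\<exists>D r. straight_line_drawing D (complete_ugraph n) \<and> edge_ordering D r \<and>
             (\<forall>t. binary_tree_in D t \<and> non_crossing_tree t \<and> increasing_tree r t
                \<longrightarrow> real (size t) \<le> C * ln (real n)))
        \<and> (\<exists>D r. straight_line_drawing D (complete_ugraph n) \<and> edge_ordering D r \<and>
             (\<forall>t. binary_tree_in D t \<and> non_crossing_tree t \<and> decreasing_tree r t
                \<longrightarrow> real (size t) \<le> C * ln (real n)))"
    using draw dec inc by (intro exI[of _ C]) blast
  have v: "parabola (real 0) \<in> verts (parabola_drawing n)" if "2 \<le> n" for n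
    unfolding parabola_drawing_verts coord_parabola using that by simp
  have plus: "real (tau_plus (complete_ugraph n)) \<le> C * ln (real n)" if n: "2 \<le> n" for n
  proof -
    \<comment> \<open>An infimum of natural numbers is at most each member, so one drawing with one
      ordering bounds both nested infima.\<close>
    have "tau_plus (complete_ugraph n) \<le> tau_plus_geom (parabola_drawing n)"
      unfolding tau_plus_def by (rule cINF_lower) (use draw in auto)
    also have "\<dots> \<le> Max {size t |t. binary_tree_in (parabola_drawing n) t \<and> non_crossing_tree t \<and>
        increasing_tree ((lev_order n)\<inverse>) t}" (is "_ \<le> ?M")
      unfolding tau_plus_geom_def by (rule cINF_lower) (use draw in auto)
    finally have "real (tau_plus (complete_ugraph n)) \<le> real ?M" by simp
    also have "\<dots> \<le> C * ln (real n)"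
      by (rule Max_sizes_le[where Q = "increasing_tree _", OF v[OF n]])
        (simp_all add: singleton_tree_monotone inc[OF n])
    finally show ?thesis .
  qed
  have minus: "real (tau_minus (complete_ugraph n)) \<le> C * ln (real n)" if n: "2 \<le> n" for n
  proof -
    have "tau_minus (complete_ugraph n) \<le> tau_minus_geom (parabola_drawing n)"
      unfolding tau_minus_def by (rule cINF_lower) (use draw in auto)
    also have "\<dots> \<le> Max {size t |t. binary_tree_in (parabola_drawing n) t \<and> non_crossing_tree t \<and>
        decreasing_tree (lev_order n) t}" (is "_ \<le> ?M")
      unfolding tau_minus_geom_def by (rule cINF_lower) (use draw in auto)
    finally have "real (tau_minus (complete_ugraph n)) \<le> real ?M" by simp
    also have "\<dots> \<le> C * ln (real n)"
      by (rule Max_sizes_le[where Q = "decreasing_tree _", OF v[OF n]])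
        (simp_all add: singleton_tree_monotone dec[OF n])
    finally show ?thesis .
  qed
  show "(\<lambda>n. real (tau_plus (complete_ugraph n))) \<in> O(\<lambda>n. ln (real n))"
    "(\<lambda>n. real (tau_minus (complete_ugraph n))) \<in> O(\<lambda>n. ln (real n))"
    by (rule bigoI[of _ C], rule eventually_mono[OF eventually_ge_at_top[of 2]],
        use plus minus in simp)+
qed

end
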